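(* Let $\mathcal{D}\subset\mathbb{R}$ be open, let $\mathcal{I}=\{1,\ldots,n\}$, let $f_j:\mathcal{D}\to\mathbb{R}$ be continuous for all $j\in\mathcal{I}$, and define $f_{\max}(t)=\max_{j\in\mathcal{I}} f_j(t)$ for $t\in\mathcal{D}$. Let $x\in\mathcal{D}$ be any local maximizer of $f_{\max}$ with $f_{\max}(x)=\gamma$. Suppose that for all $j\in\mathcal{I}$, $f_j$ is $\mathcal{C}^1$ at $x$. Then $f_{\max}$ is differentiable at $x$ with $f_{\max}'(x)=0$.
   Context: $\mathcal{C}^q$ means $q$-times continuously differentiable. *)

theory Defs
  imports "HOL-Analysis.Analysis"
begin

definition f_max :: "nat \<Rightarrow> (nat \<Rightarrow> real \<Rightarrow> real) \<Rightarrow> real \<Rightarrow> real" where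
  "f_max n f t = Max ((\<lambda>j. f j t) ` {1..n})"

definition local_maximizer :: "real set \<Rightarrow> (real \<Rightarrow> real) \<Rightarrow> real \<Rightarrow> bool" where
  "local_maximizer D g x \<longleftrightarrow> x \<in> D \<and> (\<exists>e>0. \<forall>y\<in>D. dist y x < e \<longrightarrow> g y \<le> g x)"

(* q-times continuously differentiable at the point x: the first q derivatives exist
   on a neighbourhood of x and the q-th one is continuous at x; continuity of the q-th
   derivative away from x is not required.  Only the germ of g at x matters, so for a
   function on an open domain containing x the neighbourhood may be taken inside it. *)
definition Cq_at :: "nat \<Rightarrow> (real \<Rightarrow> real) \<Rightarrow> real \<Rightarrow> bool" where
  "Cq_at q g x \<longleftrightarrow>
     (\<exists>U. open U \<and> x \<in> U \<and> (\<forall>k<q. \<forall>y\<in>U. (deriv ^^ k) g differentiable at y)) \<and>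
     isCont ((deriv ^^ q) g) x"

end

theory Submission imports Defs begin

text \<open>Call \<open>j\<close> active if \<open>f j x\<close> equals the maximum at \<open>x\<close>. An active function lies below the
maximum and touches it at \<open>x\<close>, so it inherits the local maximum and has derivative \<open>0\<close>. By
continuity the inactive functions do not contribute near \<open>x\<close>, so each difference quotient of the
maximum is that of some active function, and these finitely many quotients all tend to \<open>0\<close>.\<close>

text \<open>Separates the passage to the maximum from the extremal argument. Inactive functions need
  only continuity, since a strict inequality at \<open>x\<close> persists nearby. The slope
  \<open>d\<close> must be common to the active ones: otherwise a corner can appear, as for the
  maximum of \<open>t\<close> and \<open>-t\<close> at 0.\<close>

lemma has_real_derivative_Max_common:
  fixes f :: "'i \<Rightarrow> real \<Rightarrow> real"
  assumes fin: "finite I" and ne: "I \<noteq> {}"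
    and cont: "\<And>j. j \<in> I \<Longrightarrow> isCont (f j) x"
    and der: "\<And>j. j \<in> I \<Longrightarrow> f j x = Max ((\<lambda>j. f j x) ` I) \<Longrightarrow> (f j has_real_derivative d) (at x)"
  shows "((\<lambda>t. Max ((\<lambda>j. f j t) ` I)) has_real_derivative d) (at x)"
proof -
  define g where "g t = Max ((\<lambda>j. f j t) ` I)" for t
  have attained: "\<exists>j\<in>I. g t = f j t" for t
  proof -
    have "g t \<in> (\<lambda>j. f j t) ` I"
      unfolding g_def using fin ne by (intro Max_in) auto
    then show ?thesis
      by blast
  qed
  have upper: "f j t \<le> g t" if "j \<in> I" for j t
    using fin that unfolding g_def by simp
  obtain i where i: "i \<in> I" "g x = f i x"
    using attained by blast
  define A where "A = {j \<in> I. f j x = g x}"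
  \<comment> \<open>The comparison is with the fixed active \<open>f i\<close>, whose continuity is
    given, and not with \<open>g\<close>.\<close>
  have inactive: "\<forall>\<^sub>F y in at x. \<forall>j\<in>I - A. f j y < f i y"
  proof (rule eventually_ball_finite)
    show "finite (I - A)"
      using fin by simp
    show "\<forall>j\<in>I - A. \<forall>\<^sub>F y in at x. f j y < f i y"
    proof
      fix j assume j: "j \<in> I - A"
      then have "f j x < f i x"
        using upper[of j x] i unfolding A_def by auto
      then have "0 < f i x - f j x"
        by simp
      moreover have "((\<lambda>y. f i y - f j y) \<longlongrightarrow> f i x - f j x) (at x)"
        using cont i j by (intro tendsto_diff) (auto simp: isCont_def)
      ultimately have "\<forall>\<^sub>F y in at x. 0 < f i y - f j y"
        by (rule order_tendstoD(1)[rotated])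
      then show "\<forall>\<^sub>F y in at x. f j y < f i y"
        by simp
    qed
  qed
  have "((\<lambda>y. (g y - g x) / (y - x)) \<longlongrightarrow> d) (at x)"
    unfolding tendsto_iff
  proof (intro allI impI)
    fix e :: real assume "0 < e"
    \<comment> \<open>The index attaining \<open>g y\<close> may change with \<open>y\<close>, so
      one neighbourhood must serve all of \<open>A\<close>; finiteness provides it.\<close>
    have "\<forall>\<^sub>F y in at x. \<forall>j\<in>A. dist ((f j y - f j x) / (y - x)) d < e"
    proof (rule eventually_ball_finite)
      show "finite A"
        using fin unfolding A_def by simp
      show "\<forall>j\<in>A. \<forall>\<^sub>F y in at x. dist ((f j y - f j x) / (y - x)) d < e"
        using der \<open>0 < e\<close> unfolding A_def g_def has_field_derivative_iff tendsto_iff by blast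
    qed
    with inactive show "\<forall>\<^sub>F y in at x. dist ((g y - g x) / (y - x)) d < e"
    proof eventually_elim
      case (elim y)
      obtain j where j: "j \<in> I" "g y = f j y"
        using attained by blast
      \<comment> \<open>Otherwise \<open>g y = f j y < f i y \<le> g y\<close>.\<close>
      have "j \<in> A"
        using elim(1) j upper[OF i(1), of y] by (metis DiffI leD)
      then show ?case
        using elim(2) j unfolding A_def by auto
    qed
  qed
  then show ?thesis
    unfolding has_field_derivative_iff g_def .
qed

theorem theorem2p2:
  fixes D :: "real set" and n :: nat and f :: "nat \<Rightarrow> real \<Rightarrow> real" and x \<gamma> :: real
  assumes "open D"
    and "n \<ge> 1"
    and "\<And>j. j \<in> {1..n} \<Longrightarrow> continuous_on D (f j)"
    and "local_maximizer D (f_max n f) x"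
    and "f_max n f x = \<gamma>"
    and "\<And>j. j \<in> {1..n} \<Longrightarrow> Cq_at 1 (f j) x"
  shows "(f_max n f has_real_derivative 0) (at x)"
proof -
  obtain e where "x \<in> D" "e > 0"
    and e: "\<And>y. y \<in> D \<Longrightarrow> dist y x < e \<Longrightarrow> f_max n f y \<le> f_max n f x"
    using assms(4) unfolding local_maximizer_def by blast
  obtain r where "r > 0" "ball x r \<subseteq> D"
    using \<open>open D\<close> \<open>x \<in> D\<close> open_contains_ball by blast
  \<comment> \<open>This is the case \<open>k = 0\<close> of \<open>Cq_at\<close>, where
    \<open>deriv ^^ 0\<close> is the identity.\<close>
  have diff: "f j differentiable at x" if "j \<in> {1..n}" for j
    using assms(6)[OF that] unfolding Cq_at_def by auto
  have "((\<lambda>t. Max ((\<lambda>j. f j t) ` {1..n})) has_real_derivative 0) (at x)"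
  proof (rule has_real_derivative_Max_common)
    fix j assume j: "j \<in> {1..n}"
    show "isCont (f j) x"
      using diff[OF j] by (rule differentiable_imp_continuous_within)
    assume active: "f j x = Max ((\<lambda>j. f j x) ` {1..n})"
    obtain l where l: "(f j has_real_derivative l) (at x)"
      using diff[OF j] real_differentiable_def by blast
    \<comment> \<open>The radius \<open>r\<close> keeps \<open>y\<close> in \<open>D\<close>, the
      only place where \<open>e\<close> controls \<open>f_max\<close>.\<close>
    have "f j y \<le> f j x" if "\<bar>x - y\<bar> < min e r" for y
    proof -
      have "y \<in> D" "dist y x < e"
        using that \<open>ball x r \<subseteq> D\<close> by (auto simp: dist_real_def)
      then have "f_max n f y \<le> f j x"
        using e active by (simp add: f_max_def)
      moreover have "f j y \<le> f_max n f y"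
        using j unfolding f_max_def by simp
      ultimately show ?thesis
        by simp
    qed
    then have "l = 0"
      using DERIV_local_max[OF l, of "min e r"] \<open>e > 0\<close> \<open>r > 0\<close> by simp
    then show "(f j has_real_derivative 0) (at x)"
      using l by simp
  qed (use \<open>n \<ge> 1\<close> in auto)
  then show ?thesis
    unfolding f_max_def[abs_def] .
qed

end
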